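(* $i(\vec P_3)\leq 0.4446$ and $i(\vec C_4)\leq 0.1104$.
   Context: An orgraph (oriented graph) is a directed graph with no loops, no multiple edges, and no pair of vertices joined by edges in both directions. For a finite orgraph $\Gamma$ and an integer $n$, let $max(\Gamma;n)$ be the maximum, over all orgraphs $G$ on $n$ vertices, of the number of vertex subsets $T\subseteq V(G)$ with $|T|=|V(\Gamma)|$ such that the subgraph of $G$ induced by $T$ is isomorphic to $\Gamma$ (each such set is counted once, regardless of automorphisms of $\Gamma$). The inducibility of $\Gamma$ is $i(\Gamma):=\limsup_{n\to\infty} max(\Gamma;n)/\binom{n}{|V(\Gamma)|}$. Here $\vec P_3$ is the orgraph on vertices $a,b,c$ with edges $a\to b$ and $b\to c$ only (directed path with 3 vertices), and $\vec C_4$ is the orgraph on vertices $v_1,v_2,v_3,v_4$ with edges $v_1\to v_2$, $v_2\to v_3$, $v_3\to v_4$, $v_4\to v_1$ only (directed 4-cycle). *)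

theory Defs
  imports Complex_Main "HOL-Library.Liminf_Limsup" "HOL-Library.Extended_Real"
begin

definition orgraph :: "'a set \<Rightarrow> ('a \<times> 'a) set \<Rightarrow> bool" where
  "orgraph V E \<longleftrightarrow> finite V \<and> E \<subseteq> V \<times> V \<and> (\<forall>x. (x, x) \<notin> E)
     \<and> (\<forall>x y. (x, y) \<in> E \<longrightarrow> (y, x) \<notin> E)"

definition induced_copies ::
  "'a set \<Rightarrow> ('a \<times> 'a) set \<Rightarrow> 'b set \<Rightarrow> ('b \<times> 'b) set \<Rightarrow> 'b set set" where
  "induced_copies VH EH V E =
     {T. T \<subseteq> V \<and> card T = card VH \<and>
         (\<exists>f. bij_betw f VH T \<and>
              (\<forall>u\<in>VH. \<forall>v\<in>VH. (u, v) \<in> EH \<longleftrightarrow> (f u, f v) \<in> E))}"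

text \<open>max(H;n): maximum over all orgraphs on n vertices (w.l.o.g. on vertex set {0..<n}).\<close>
definition max_ind :: "'a set \<Rightarrow> ('a \<times> 'a) set \<Rightarrow> nat \<Rightarrow> nat" where
  "max_ind VH EH n =
     Max {card (induced_copies VH EH {0..<n} E) | E. orgraph {0..<n::nat} E}"

definition inducibility :: "'a set \<Rightarrow> ('a \<times> 'a) set \<Rightarrow> ereal" where
  "inducibility VH EH =
     limsup (\<lambda>n. ereal (real (max_ind VH EH n) / real (n choose card VH)))"

definition P3_V :: "nat set" where "P3_V = {0, 1, 2}"
definition P3_E :: "(nat \<times> nat) set" where "P3_E = {(0, 1), (1, 2)}"

definition C4_V :: "nat set" where "C4_V = {0, 1, 2, 3}"
definition C4_E :: "(nat \<times> nat) set" where "C4_E = {(0, 1), (1, 2), (2, 3), (3, 0)}"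

end

theory Submission
  imports Defs
begin

text \<open>
  A flag algebra argument on four vertices. For a pair of vertices \<open>x, y\<close> and a function \<open>g\<close> of the
  way a third vertex \<open>z\<close> is attached to the pair, the sum of \<open>(\<Sum>z. g z)\<^sup>2\<close> over all
  non-adjacent pairs, or over all edges \<open>x \<rightarrow> y\<close>, is nonnegative; expanded, it is a sum over
  quadruples of vertices. With suitable weights, the symmetrisation of two squares for non-adjacent
  pairs, two squares for edges and the indicator of the wanted orgraph is bounded by a constant on
  each of the \<open>3\<^sup>6\<close> labelled orgraphs on four vertices. This yields the densities \<open>3/7\<close> for the
  path and \<open>3/29\<close> for the cycle.

  Quadruples may have repeated entries: coinciding vertices look like non-adjacent twins, so the
  pointwise bound covers them and there is no error term.
\<close>

text \<open>The skew-symmetric adjacency matrix. Its diagonal vanishes, so a repeated vertex reads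
  as a non-adjacent pair.\<close>

definition orient :: "('a \<times> 'a) set \<Rightarrow> 'a \<Rightarrow> 'a \<Rightarrow> int" where
  "orient E x y = of_bool ((x, y) \<in> E) - of_bool ((y, x) \<in> E)"

lemma orient_swap: "orient E y x = - orient E x y"
  by (simp add: orient_def)

lemma orient_cases: "orient E x y \<in> {-1, 0, 1}"
  by (auto simp: orient_def of_bool_def)

text \<open>Opposite edges would cancel to 0; an orgraph has none, so the sign determines the
  pair.\<close>

lemma orient_eq_iff:
  assumes "orgraph V E"
  shows "orient E x y = 1 \<longleftrightarrow> (x, y) \<in> E"
    and "orient E x y = 0 \<longleftrightarrow> (x, y) \<notin> E \<and> (y, x) \<notin> E"
  using assms by (auto simp: orgraph_def orient_def of_bool_def split: if_splits)

section \<open>Sums over quadruples and their symmetrisation\<close>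

definition sum4 :: "'a set \<Rightarrow> ('a \<Rightarrow> 'a \<Rightarrow> 'a \<Rightarrow> 'a \<Rightarrow> int) \<Rightarrow> int" where
  "sum4 V G = (\<Sum>x\<in>V. \<Sum>y\<in>V. \<Sum>z\<in>V. \<Sum>w\<in>V. G x y z w)"

lemma sum4_add: "sum4 V (\<lambda>x y z w. G x y z w + H x y z w) = sum4 V G + sum4 V H"
  by (simp add: sum4_def sum.distrib)

lemma sum4_mono:
  "(\<And>x y z w. G x y z w \<le> H x y z w) \<Longrightarrow> sum4 V G \<le> sum4 V H"
  unfolding sum4_def by (intro sum_mono)

lemma sum4_const: "sum4 V (\<lambda>x y z w. c) = c * int (card V) ^ 4"
  by (simp add: sum4_def algebra_simps eval_nat_numeral)

lemma sum4_swap12: "sum4 V (\<lambda>x y z w. G y x z w) = sum4 V G"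
  unfolding sum4_def by (rule sum.swap)

lemma sum4_swap23: "sum4 V (\<lambda>x y z w. G x z y w) = sum4 V G"
  unfolding sum4_def by (rule sum.cong[OF refl], rule sum.swap)

lemma sum4_swap34: "sum4 V (\<lambda>x y z w. G x y w z) = sum4 V G"
  unfolding sum4_def by (rule sum.cong[OF refl], rule sum.cong[OF refl], rule sum.swap)

definition sym2 :: "('a \<Rightarrow> 'a \<Rightarrow> 'a \<Rightarrow> 'a \<Rightarrow> int) \<Rightarrow> 'a \<Rightarrow> 'a \<Rightarrow> 'a \<Rightarrow> 'a \<Rightarrow> int" where
  "sym2 G x y z w = G x y z w + G y x z w"

definition sym3 :: "('a \<Rightarrow> 'a \<Rightarrow> 'a \<Rightarrow> 'a \<Rightarrow> int) \<Rightarrow> 'a \<Rightarrow> 'a \<Rightarrow> 'a \<Rightarrow> 'a \<Rightarrow> int" where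
  "sym3 G x y z w = sym2 G x y z w + sym2 G x z y w + sym2 G y z x w"

text \<open>Built along the chain of symmetric groups S2 < S3 < S4: each level chooses the vertex
  for its last slot, so all 24 permutations occur once.\<close>

definition sym4 :: "('a \<Rightarrow> 'a \<Rightarrow> 'a \<Rightarrow> 'a \<Rightarrow> int) \<Rightarrow> 'a \<Rightarrow> 'a \<Rightarrow> 'a \<Rightarrow> 'a \<Rightarrow> int" where
  "sym4 G x y z w = sym3 G x y z w + sym3 G x y w z + sym3 G x z w y + sym3 G y z w x"

lemma sum4_sym4: "sum4 V (sym4 G) = 24 * sum4 V G"
proof -
  have sym2: "sum4 V (sym2 G) = 2 * sum4 V G"
    using sum4_add[of V G "\<lambda>x y z w. G y x z w"] sum4_swap12[of V G]
    by (simp add: sym2_def[abs_def])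
  \<comment> \<open>The remaining rearrangements are products of adjacent transpositions, under
    which the sum is invariant.\<close>
  have rot3: "sum4 V (\<lambda>x y z w. H y z x w) = sum4 V H" for H
    using sum4_swap12[of V "\<lambda>x y z w. H x z y w"] sum4_swap23[of V H] by simp
  have rot4: "sum4 V (\<lambda>x y z w. H y z w x) = sum4 V H" for H
    using rot3[of "\<lambda>x y z w. H x y w z"] sum4_swap34[of V H] by simp
  have rot34: "sum4 V (\<lambda>x y z w. H x z w y) = sum4 V H" for H
    using sum4_swap23[of V "\<lambda>x y z w. H x y w z"] sum4_swap34[of V H] by simp
  have sym3: "sum4 V (sym3 G) = 6 * sum4 V G"
    unfolding sym3_def[abs_def] sum4_add sum4_swap23[of V "sym2 G"] rot3[of "sym2 G"]
    by (simp add: sym2)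
  show ?thesis
    unfolding sym4_def[abs_def] sum4_add sum4_swap34[of V "sym3 G"] rot34[of "sym3 G"]
      rot4[of "sym3 G"]
    by (simp add: sym3)
qed

text \<open>
  Here \<open>p\<close> orients the pair \<open>x, y\<close>, and \<open>(u, v)\<close>, \<open>(u', v')\<close> are the orientations of \<open>x\<close> and
  \<open>y\<close> towards \<open>z\<close> and \<open>w\<close>. The four squares and their weights below come from rounding a
  trace-minimal solution of the semidefinite program and re-optimising the weights by linear
  programming.
\<close>
definition flag_form :: "int \<Rightarrow> int \<Rightarrow> int \<Rightarrow> int \<Rightarrow> int \<Rightarrow> int \<Rightarrow> int \<Rightarrow> int \<Rightarrow> int \<Rightarrow> int" where
  "flag_form a b c d p u v u' v' =
     (if p = 0 then
        a * ((of_bool (u = 1 \<and> v = -1) - of_bool (u = -1 \<and> v = 1)) *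
             (of_bool (u' = 1 \<and> v' = -1) - of_bool (u' = -1 \<and> v' = 1))) +
        b * ((of_bool (u * v = -1) - of_bool (u * v = 0)) *
             (of_bool (u' * v' = -1) - of_bool (u' * v' = 0)))
      else if p = 1 then
        c * ((of_bool (u = 0 \<and> v = 1) - of_bool (u = -1 \<and> v = 0)) *
             (of_bool (u' = 0 \<and> v' = 1) - of_bool (u' = -1 \<and> v' = 0))) +
        d * ((u - v) * (u' - v'))
      else 0)"

definition flag_kernel ::
  "int \<Rightarrow> int \<Rightarrow> int \<Rightarrow> int \<Rightarrow> ('a \<Rightarrow> 'a \<Rightarrow> int) \<Rightarrow> 'a \<Rightarrow> 'a \<Rightarrow> 'a \<Rightarrow> 'a \<Rightarrow> int" where
  "flag_kernel a b c d s x y z w = flag_form a b c d (s x y) (s x z) (s y z) (s x w) (s y w)"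

text \<open>For fixed \<open>x\<close>, \<open>y\<close> each term is a weight times
  \<open>g z * g w\<close> with one and the same \<open>g\<close>, so summing over \<open>z\<close>
  and \<open>w\<close> gives a weighted square.\<close>

lemma sum4_flag_kernel_nonneg:
  assumes "0 \<le> a" "0 \<le> b" "0 \<le> c" "0 \<le> d"
  shows "0 \<le> sum4 V (flag_kernel a b c d s)"
  unfolding sum4_def
proof (rule sum_nonneg, rule sum_nonneg)
  fix x y
  have square: "(\<Sum>z\<in>V. \<Sum>w\<in>V. k * (g z * g w)) = k * (sum g V)\<^sup>2" for k and g :: "'a \<Rightarrow> int"
    unfolding power2_eq_square sum_product by (simp add: sum_distrib_left)
  show "0 \<le> (\<Sum>z\<in>V. \<Sum>w\<in>V. flag_kernel a b c d s x y z w)"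
    using assms
    by (cases "s x y = 0"; cases "s x y = 1")
      (simp_all add: flag_kernel_def flag_form_def sum.distrib square)
qed

section \<open>Pointwise bounds on four vertices\<close>

definition path3_ind :: "('a \<Rightarrow> 'a \<Rightarrow> int) \<Rightarrow> 'a \<Rightarrow> 'a \<Rightarrow> 'a \<Rightarrow> int" where
  "path3_ind s x y z = of_bool (s x y = 1 \<and> s y z = 1 \<and> s x z = 0)"

definition cycle4_ind :: "('a \<Rightarrow> 'a \<Rightarrow> int) \<Rightarrow> 'a \<Rightarrow> 'a \<Rightarrow> 'a \<Rightarrow> 'a \<Rightarrow> int" where
  "cycle4_ind s x y z w =
     of_bool (s x y = 1 \<and> s y z = 1 \<and> s z w = 1 \<and> s x w = -1 \<and> s x z = 0 \<and> s y w = 0)"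

text \<open>Rewriting by \<open>swap\<close> leaves six signs, hence 729 numerical cases. The bound
  is attained when all signs are 0: each of the 24 terms then equals the second weight, 2.\<close>

lemma path3_pointwise:
  assumes "\<And>x y. s y x = - s x y" and "\<And>x y. s x y \<in> {-1, 0, 1 :: int}"
  shows "sym4 (\<lambda>x y z w. flag_kernel 6 2 9 5 s x y z w + 28 * path3_ind s x y z) x y z w \<le> 48"
proof -
  note swap = assms(1)[of x y] assms(1)[of x z] assms(1)[of x w]
    assms(1)[of y z] assms(1)[of y w] assms(1)[of z w]
  show ?thesis
    using assms(2)[of x y] assms(2)[of x z] assms(2)[of x w]
      assms(2)[of y z] assms(2)[of y w] assms(2)[of z w]
    unfolding sym4_def sym3_def sym2_def flag_kernel_def path3_ind_def swap
    by (elim insertE emptyE) (simp_all add: flag_form_def)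
qed

lemma cycle4_pointwise:
  assumes "\<And>x y. s y x = - s x y" and "\<And>x y. s x y \<in> {-1, 0, 1 :: int}"
  shows "sym4 (\<lambda>x y z w. flag_kernel 11 1 19 3 s x y z w + 58 * cycle4_ind s x y z w) x y z w \<le> 24"
proof -
  note swap = assms(1)[of x y] assms(1)[of x z] assms(1)[of x w]
    assms(1)[of y z] assms(1)[of y w] assms(1)[of z w]
  show ?thesis
    using assms(2)[of x y] assms(2)[of x z] assms(2)[of x w]
      assms(2)[of y z] assms(2)[of y w] assms(2)[of z w]
    unfolding sym4_def sym3_def sym2_def flag_kernel_def cycle4_ind_def swap
    by (elim insertE emptyE) (simp_all add: flag_form_def)
qed

text \<open>Symmetrising multiplies the sum by 24, so the pointwise bound controls flag sum plus
  \<open>m\<close> times the sum of \<open>G\<close>; the nonnegative flag sum is then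
  dropped.\<close>

lemma sum4_le_of_pointwise:
  assumes "\<And>x y z w. sym4 (\<lambda>x y z w. flag_kernel a b c d s x y z w + m * G x y z w) x y z w \<le> 24 * q"
    and "0 \<le> a" "0 \<le> b" "0 \<le> c" "0 \<le> d"
  shows "m * sum4 V G \<le> q * int (card V) ^ 4"
proof -
  have "24 * sum4 V (\<lambda>x y z w. flag_kernel a b c d s x y z w + m * G x y z w)
      \<le> 24 * q * int (card V) ^ 4"
    unfolding sum4_sym4[symmetric] sum4_const[symmetric] by (intro sum4_mono assms(1))
  moreover have "sum4 V (\<lambda>x y z w. m * G x y z w) = m * sum4 V G"
    by (simp add: sum4_def sum_distrib_left)
  ultimately show ?thesis
    using sum4_flag_kernel_nonneg[OF assms(2-5), of V s]
    unfolding sum4_add by simp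
qed

section \<open>From ordered tuples to induced copies\<close>

lemma card_induced_P3_le:
  assumes "orgraph V E"
  shows "14 * card (induced_copies P3_V P3_E V E) \<le> card V ^ 3"
proof -
  define s where "s = orient E"
  define R where "R = (V \<times> V \<times> V) \<inter> {(x, y, z). s x y = 1 \<and> s y z = 1 \<and> s x z = 0}"
  have fin: "finite V"
    using assms by (simp add: orgraph_def)
  then have finR: "finite R"
    by (simp add: R_def)
  \<comment> \<open>The path has only the trivial automorphism, so passing from sets to ordered
    triples loses no factor.\<close>
  have "induced_copies P3_V P3_E V E \<subseteq> (\<lambda>(x, y, z). {x, y, z}) ` R"
  proof
    fix T assume "T \<in> induced_copies P3_V P3_E V E"
    then obtain f where T: "T \<subseteq> V" "bij_betw f {0, 1, 2} T"
      and f: "\<forall>u\<in>{0, 1, 2}. \<forall>v\<in>{0, 1, 2}. (u, v) \<in> P3_E \<longleftrightarrow> (f u, f v) \<in> E"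
      by (auto simp: induced_copies_def P3_V_def)
    have "T = {f 0, f 1, f 2}"
      using T(2) by (auto simp: bij_betw_def)
    moreover have "(f 0, f 1, f 2) \<in> R"
      using T(1) \<open>T = _\<close> f by (auto simp: R_def s_def orient_eq_iff[OF assms] P3_E_def)
    ultimately show "T \<in> (\<lambda>(x, y, z). {x, y, z}) ` R"
      by force
  qed
  then have le: "card (induced_copies P3_V P3_E V E) \<le> card R"
    by (rule surj_card_le[OF finR])
  have "(\<Sum>x\<in>V. \<Sum>y\<in>V. \<Sum>z\<in>V. path3_ind s x y z) = int (card R)"
    using fin unfolding R_def path3_ind_def
    by (simp add: sum.cartesian_product split_def flip: sum_of_bool_eq)
  \<comment> \<open>The fourth vertex is unconstrained and contributes a factor
    \<open>card V\<close>, cancelled below when \<open>V\<close> is nonempty.\<close>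
  then have "sum4 V (\<lambda>x y z w. path3_ind s x y z) = int (card V) * int (card R)"
    by (simp add: sum4_def flip: sum_distrib_left)
  moreover have "28 * sum4 V (\<lambda>x y z w. path3_ind s x y z) \<le> 2 * int (card V) ^ 4"
    by (rule sum4_le_of_pointwise[of 6 2 9 5 s])
      (simp_all add: s_def path3_pointwise[OF orient_swap orient_cases])
  ultimately have "int (card V) * (14 * int (card R)) \<le> int (card V) * int (card V) ^ 3"
    by (simp add: eval_nat_numeral)
  then have "14 * int (card R) \<le> int (card V) ^ 3" if "V \<noteq> {}"
    using that fin by (simp add: card_gt_0_iff)
  moreover have "card R = 0" if "V = {}"
    using that by (simp add: R_def)
  ultimately have "14 * card R \<le> card V ^ 3"
    by (cases "V = {}") (simp, metis of_nat_le_iff of_nat_mult of_nat_numeral of_nat_power)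
  with le show ?thesis
    by linarith
qed

lemma card_induced_C4_le:
  assumes "orgraph V E"
  shows "232 * card (induced_copies C4_V C4_E V E) \<le> card V ^ 4"
proof -
  define s where "s = orient E"
  define R where "R = (V \<times> V \<times> V \<times> V) \<inter> {(x, y, z, w).
    s x y = 1 \<and> s y z = 1 \<and> s z w = 1 \<and> s x w = -1 \<and> s x z = 0 \<and> s y w = 0}"
  define \<phi> where "\<phi> = (\<lambda>(x, y, z, w). {x, y, z, w :: 'a})"
  have fin: "finite V"
    using assms by (simp add: orgraph_def)
  then have finR: "finite R"
    by (simp add: R_def)
  have "induced_copies C4_V C4_E V E \<subseteq> \<phi> ` R"
  proof
    fix T assume "T \<in> induced_copies C4_V C4_E V E"
    then obtain f where T: "T \<subseteq> V" "bij_betw f {0, 1, 2, 3} T"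
      and f: "\<forall>u\<in>{0, 1, 2, 3}. \<forall>v\<in>{0, 1, 2, 3}. (u, v) \<in> C4_E \<longleftrightarrow> (f u, f v) \<in> E"
      unfolding induced_copies_def C4_V_def by blast
    have "T = {f 0, f 1, f 2, f 3}"
      using bij_betw_imp_surj_on[OF T(2)] by simp
    moreover have "(f 0, f 1) \<in> E" "(f 1, f 2) \<in> E" "(f 2, f 3) \<in> E" "(f 3, f 0) \<in> E"
      "(f 0, f 2) \<notin> E" "(f 2, f 0) \<notin> E" "(f 1, f 3) \<notin> E" "(f 3, f 1) \<notin> E"
      by (subst f[rule_format, symmetric]; simp add: C4_E_def)+
    then have "(f 0, f 1, f 2, f 3) \<in> R"
      using T(1) \<open>T = _\<close> orient_swap[of E "f 0" "f 3"] orient_eq_iff(1)[OF assms, of "f 3" "f 0"]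
      by (simp add: R_def s_def orient_eq_iff[OF assms])
    ultimately show "T \<in> \<phi> ` R"
      by (force simp: \<phi>_def)
  qed
  then have le: "card (induced_copies C4_V C4_E V E) \<le> card (\<phi> ` R)"
    by (rule card_mono[OF finite_imageI[OF finR]])
  \<comment> \<open>The four rotations of a cycle give the same vertex set; this turns 58 into
    232.\<close>
  have fibre: "4 \<le> card {t \<in> R. \<phi> t = T}" if T_in: "T \<in> \<phi> ` R" for T
  proof -
    obtain x y z w where T: "T = {x, y, z, w}" and R: "(x, y, z, w) \<in> R"
      using T_in by (auto simp: \<phi>_def)
    have swap: "s v u = - s u v" for u v
      unfolding s_def by (rule orient_swap)
    have self: "s u u = 0" for u
      by (simp add: s_def orient_def)
    \<comment> \<open>Neighbours differ because the diagonal is 0; opposite vertices differ because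
      equality would give one pair two opposite signs.\<close>
    have dist: "distinct [x, y, z, w]"
      using R swap[of x y] swap[of y z] self by (auto simp: R_def)
    have "{(x, y, z, w), (y, z, w, x), (z, w, x, y), (w, x, y, z)} \<subseteq> {t \<in> R. \<phi> t = T}"
      using R swap[of x w] swap[of x z] swap[of y w] swap[of x y] swap[of y z] swap[of z w]
      by (auto simp: R_def \<phi>_def T)
    from card_mono[OF _ this] show ?thesis
      using finR dist by simp
  qed
  have "4 * card (\<phi> ` R) = (\<Sum>T\<in>\<phi> ` R. 4)"
    by simp
  also have "\<dots> \<le> (\<Sum>T\<in>\<phi> ` R. card {t \<in> R. \<phi> t = T})"
    by (intro sum_mono fibre)
  also have "\<dots> = card R"
    using sum.image_gen[OF finR, of "\<lambda>_. 1 :: nat" \<phi>] by simp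
  finally have "4 * card (induced_copies C4_V C4_E V E) \<le> card R"
    using le by linarith
  moreover have "sum4 V (cycle4_ind s) = int (card R)"
    using fin unfolding R_def cycle4_ind_def sum4_def
    by (simp add: sum.cartesian_product split_def flip: sum_of_bool_eq)
  moreover have "58 * sum4 V (cycle4_ind s) \<le> 1 * int (card V) ^ 4"
    by (rule sum4_le_of_pointwise[of 11 1 19 3 s])
      (simp_all add: s_def cycle4_pointwise[OF orient_swap orient_cases])
  ultimately have "int (232 * card (induced_copies C4_V C4_E V E)) \<le> int (card V ^ 4)"
    by simp
  then show ?thesis
    by (simp only: of_nat_le_iff)
qed

section \<open>Passing to the limit\<close>

lemma inducibility_le:
  assumes "\<And>n E. orgraph {0..<n} E \<Longrightarrow>
    real (card (induced_copies VH EH {0..<n} E)) \<le> b * real n ^ card VH"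
  shows "inducibility VH EH \<le> ereal (b * fact (card VH))"
proof -
  define k where "k = card VH"
  \<comment> \<open>For n \<ge> k this is b n^k divided by the binomial coefficient, split into k
    factors that each tend to 1.\<close>
  define X where "X = (\<lambda>n. b * fact k * (\<Prod>i = 0..<k. real n / (real n - real i)))"
  have max_le: "real (max_ind VH EH n) \<le> b * real n ^ k" for n
  proof -
    let ?M = "{card (induced_copies VH EH {0..<n} E) | E. orgraph {0..<n} E}"
    have "?M \<subseteq> (\<lambda>E. card (induced_copies VH EH {0..<n} E)) ` Pow ({0..<n} \<times> {0..<n})"
      by (auto simp: orgraph_def)
    then have "finite ?M"
      by (rule finite_subset) simp
    \<comment> \<open>The edgeless orgraph makes the set nonempty, so its maximum is
      attained.\<close>
    moreover have "orgraph {0..<n} {}"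
      by (simp add: orgraph_def)
    then have "?M \<noteq> {}"
      by blast
    ultimately have "max_ind VH EH n \<in> ?M"
      unfolding max_ind_def by (rule Max_in)
    then show ?thesis
      using assms by (auto simp: k_def)
  qed
  have ratio_le: "real (max_ind VH EH n) / real (n choose k) \<le> X n" if "n \<ge> k" for n
  proof -
    have pos: "(\<Prod>i = 0..<k. real n - real i) > 0"
      using that by (intro prod_pos) auto
    have "real (n choose k) = (\<Prod>i = 0..<k. real n - real i) / fact k"
      by (simp add: binomial_gbinomial gbinomial_prod_rev)
    then have "real (max_ind VH EH n) / real (n choose k)
        = real (max_ind VH EH n) * (fact k / (\<Prod>i = 0..<k. real n - real i))"
      by simp
    also have "\<dots> \<le> b * real n ^ k * (fact k / (\<Prod>i = 0..<k. real n - real i))"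
      using pos by (intro mult_right_mono max_le) simp
    also have "\<dots> = X n"
      by (simp add: X_def prod_dividef)
    finally show ?thesis .
  qed
  have "(\<lambda>n. real n / (real n - real i)) \<longlonglongrightarrow> 1" for i
  proof -
    \<comment> \<open>Replacing n by n + i turns the factor into 1 + i/n for n > 0.\<close>
    have "(\<lambda>n. 1 + real i / real n) \<longlonglongrightarrow> 1 + 0"
      by (intro tendsto_intros lim_const_over_n)
    then have "(\<lambda>n. 1 + real i / real n) \<longlonglongrightarrow> 1"
      by simp
    moreover have "\<forall>\<^sub>F n in sequentially.
        1 + real i / real n = real (n + i) / (real (n + i) - real i)"
      by (rule eventually_mono[OF eventually_gt_at_top[of 0]]) (simp add: field_simps)
    ultimately have "(\<lambda>n. real (n + i) / (real (n + i) - real i)) \<longlonglongrightarrow> 1"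
      by (rule Lim_transform_eventually)
    then show ?thesis
      by (rule LIMSEQ_offset)
  qed
  then have "X \<longlonglongrightarrow> b * fact k * (\<Prod>i = 0..<k. 1)"
    unfolding X_def by (intro tendsto_intros)
  then have lim: "(\<lambda>n. ereal (X n)) \<longlonglongrightarrow> ereal (b * fact k)"
    by simp
  have "inducibility VH EH \<le> limsup (\<lambda>n. ereal (X n))"
    unfolding inducibility_def k_def[symmetric]
    by (intro Limsup_mono eventually_mono[OF eventually_ge_at_top[of k]]) (simp add: ratio_le)
  also have "\<dots> = ereal (b * fact k)"
    by (intro lim_imp_Limsup lim) simp
  finally show ?thesis
    by (simp add: k_def)
qed

theorem theorem2:
  shows "inducibility P3_V P3_E \<le> ereal 0.4446 \<and> inducibility C4_V C4_E \<le> ereal 0.1104"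
proof
  have card3: "card P3_V = 3" and card4: "card C4_V = 4"
    by (simp_all add: P3_V_def C4_V_def)
  have "inducibility P3_V P3_E \<le> ereal (1 / 14 * fact (card P3_V))"
  proof (rule inducibility_le)
    fix n :: nat and E assume "orgraph {0..<n} E"
    from card_induced_P3_le[OF this]
    have "real (14 * card (induced_copies P3_V P3_E {0..<n} E)) \<le> real (n ^ 3)"
      by (simp only: of_nat_le_iff card_atLeastLessThan diff_zero)
    then show "real (card (induced_copies P3_V P3_E {0..<n} E)) \<le> 1 / 14 * real n ^ card P3_V"
      by (simp add: card3)
  qed
  \<comment> \<open>3!/14 = 3/7 < 0.4286.\<close>
  also have "\<dots> \<le> ereal 0.4446"
    by (simp add: card3 fact_numeral)
  finally show "inducibility P3_V P3_E \<le> ereal 0.4446" .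
  have "inducibility C4_V C4_E \<le> ereal (1 / 232 * fact (card C4_V))"
  proof (rule inducibility_le)
    fix n :: nat and E assume "orgraph {0..<n} E"
    from card_induced_C4_le[OF this]
    have "real (232 * card (induced_copies C4_V C4_E {0..<n} E)) \<le> real (n ^ 4)"
      by (simp only: of_nat_le_iff card_atLeastLessThan diff_zero)
    then show "real (card (induced_copies C4_V C4_E {0..<n} E)) \<le> 1 / 232 * real n ^ card C4_V"
      by (simp add: card4)
  qed
  \<comment> \<open>4!/232 = 3/29 < 0.1035.\<close>
  also have "\<dots> \<le> ereal 0.1104"
    by (simp add: card4 fact_numeral)
  finally show "inducibility C4_V C4_E \<le> ereal 0.1104" .
qed

end
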